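(* Let $\Sigma$ be a finite nonempty set, let $\mu\in\mathbb{P}(\Sigma)$ be a fixed probability vector, let $\ell=(\ell_i)_{i\in\Sigma}$ be a vector of non-negative reals with $\ell_{\min}<\ell_{\max}$, and let $R\in[0,2]$. Let $$D^+(R)=\max\Big\{\sum_{i\in\Sigma}\ell_i\nu_i:\ \nu\in\mathbb{P}(\Sigma),\ \sum_{i\in\Sigma}|\nu_i-\mu_i|\le R\Big\}.$$ Then the maximum is attained and $$D^+(R)=\ell_{\max}\,\nu^*(\Sigma^0)+\ell_{\min}\,\nu^*(\Sigma_0)+\sum_{k=1}^{r}\ell(\Sigma_k)\,\nu^*(\Sigma_k),$$ where the masses of the optimal (maximizing) probability vector $\nu^*$ are given by $$\nu^*(\Sigma^0)=\mu(\Sigma^0)+\alpha,$$ $$\nu^*(\Sigma_0)=\big(\mu(\Sigma_0)-\alpha\big)^+,$$ $$\nu^*(\Sigma_k)=\Big(\mu(\Sigma_k)-\Big(\alpha-\sum_{j=1}^{k}\mu(\Sigma_{j-1})\Big)^+\Big)^+,\qquad k=1,\dots,r,$$ $$\alpha=\min\Big(\frac{R}{2},\,1-\mu(\Sigma^0)\Big).$$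
   Context: $\mathbb{P}(\Sigma)$ is the set of probability vectors $p=(p_i)_{i\in\Sigma}$, $p_i\ge 0$, $\sum_{i}p_i=1$. For $p\in\mathbb{P}(\Sigma)$ and $A\subseteq\Sigma$, $p(A)=\sum_{i\in A}p_i$. For a real $x$, $x^+=\max(x,0)$. Set $\ell_{\max}=\max_{i\in\Sigma}\ell_i$, $\ell_{\min}=\min_{i\in\Sigma}\ell_i$, $\Sigma^0=\{i\in\Sigma:\ell_i=\ell_{\max}\}$, $\Sigma_0=\{i\in\Sigma:\ell_i=\ell_{\min}\}$. Recursively, for $k=1,2,\dots$, as long as $\Sigma\setminus(\Sigma^0\cup\Sigma_0\cup\dots\cup\Sigma_{k-1})$ is nonempty, let $\ell(\Sigma_k)=\min\{\ell_i: i\in\Sigma\setminus(\Sigma^0\cup\Sigma_0\cup\dots\cup\Sigma_{k-1})\}$ and $\Sigma_k=\{i\in\Sigma:\ell_i=\ell(\Sigma_k)\}$. Let $r$ be the number of sets $\Sigma_k$ ($k\ge1$) so obtained, i.e. the number of distinct values of $\ell$ strictly between $\ell_{\min}$ and $\ell_{\max}$; if $r=0$ the sum over $k$ is empty. *)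

theory Defs
  imports Complex_Main
begin

text \<open>The alphabet is a finite set \<open>S\<close>; vectors indexed by it are total functions whose values
  outside \<open>S\<close> are irrelevant. For \<open>A \<subseteq> S\<close> the mass \<open>p(A)\<close> is \<open>sum p A\<close>.\<close>

definition prob_vectors :: "'a set \<Rightarrow> ('a \<Rightarrow> real) set" where
  "prob_vectors S = {p. (\<forall>i\<in>S. 0 \<le> p i) \<and> (\<Sum>i\<in>S. p i) = 1}"

definition pos_part :: "real \<Rightarrow> real" where
  "pos_part x = max x 0"

definition l_max :: "'a set \<Rightarrow> ('a \<Rightarrow> real) \<Rightarrow> real" where
  "l_max S l = Max (l ` S)"

definition l_min :: "'a set \<Rightarrow> ('a \<Rightarrow> real) \<Rightarrow> real" where
  "l_min S l = Min (l ` S)"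

definition Sigma_top :: "'a set \<Rightarrow> ('a \<Rightarrow> real) \<Rightarrow> 'a set" where
  "Sigma_top S l = {i \<in> S. l i = l_max S l}"

text \<open>\<open>Sigma_low S l k\<close> is \<open>\<Sigma>\<^sub>k\<close>. Once no letters remain the paper's recursion stops; here the
  later sets are empty, and they are counted neither in \<open>num_levels\<close> nor used below.\<close>

fun Sigma_low :: "'a set \<Rightarrow> ('a \<Rightarrow> real) \<Rightarrow> nat \<Rightarrow> 'a set" where
  "Sigma_low S l k =
     (if k = 0 then {i \<in> S. l i = l_min S l}
      else let rest = S - (Sigma_top S l \<union> (\<Union>j\<in>{..<k}. Sigma_low S l j))
           in if rest = {} then {} else {i \<in> S. l i = Min (l ` rest)})"

declare Sigma_low.simps [simp del]

definition remaining :: "'a set \<Rightarrow> ('a \<Rightarrow> real) \<Rightarrow> nat \<Rightarrow> 'a set" where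
  "remaining S l k = S - (Sigma_top S l \<union> (\<Union>j\<in>{..<k}. Sigma_low S l j))"

definition level :: "'a set \<Rightarrow> ('a \<Rightarrow> real) \<Rightarrow> nat \<Rightarrow> real" where
  "level S l k = Min (l ` remaining S l k)"

lemma Sigma_low_0: "Sigma_low S l 0 = {i \<in> S. l i = l_min S l}"
  by (simp add: Sigma_low.simps)

lemma Sigma_low_level:
  assumes "1 \<le> k" and "remaining S l k \<noteq> {}"
  shows "Sigma_low S l k = {i \<in> S. l i = level S l k}"
  using assms by (subst Sigma_low.simps) (auto simp: remaining_def level_def Let_def)

definition num_levels :: "'a set \<Rightarrow> ('a \<Rightarrow> real) \<Rightarrow> nat" where
  "num_levels S l = card {k. 1 \<le> k \<and> remaining S l k \<noteq> {}}"

definition feasible :: "'a set \<Rightarrow> ('a \<Rightarrow> real) \<Rightarrow> real \<Rightarrow> ('a \<Rightarrow> real) set" where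
  "feasible S \<mu> R = {\<nu> \<in> prob_vectors S. (\<Sum>i\<in>S. \<bar>\<nu> i - \<mu> i\<bar>) \<le> R}"

definition payoff :: "'a set \<Rightarrow> ('a \<Rightarrow> real) \<Rightarrow> ('a \<Rightarrow> real) \<Rightarrow> real" where
  "payoff S l \<nu> = (\<Sum>i\<in>S. l i * \<nu> i)"

text \<open>The feasible set is infinite in general, so the maximum is written as a supremum; that it is
  attained is part of the theorem.\<close>

definition D_plus :: "'a set \<Rightarrow> ('a \<Rightarrow> real) \<Rightarrow> ('a \<Rightarrow> real) \<Rightarrow> real \<Rightarrow> real" where
  "D_plus S \<mu> l R = Sup (payoff S l ` feasible S \<mu> R)"

definition maximizer ::
  "'a set \<Rightarrow> ('a \<Rightarrow> real) \<Rightarrow> ('a \<Rightarrow> real) \<Rightarrow> real \<Rightarrow> ('a \<Rightarrow> real) \<Rightarrow> bool" where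
  "maximizer S \<mu> l R \<nu> \<longleftrightarrow> is_arg_max (payoff S l) (\<lambda>p. p \<in> feasible S \<mu> R) \<nu>"

definition alpha :: "'a set \<Rightarrow> ('a \<Rightarrow> real) \<Rightarrow> ('a \<Rightarrow> real) \<Rightarrow> real \<Rightarrow> real" where
  "alpha S \<mu> l R = min (R / 2) (1 - sum \<mu> (Sigma_top S l))"

end

theory Submission imports Defs begin

text \<open>Write \<open>G\<^sub>\<nu>(t) = \<nu>{l \<le> t}\<close>. Since \<open>\<nu>\<close> and \<open>\<mu>\<close> have the same total mass, the \<open>L\<^sup>1\<close>
  constraint gives \<open>G\<^sub>\<nu>(t) \<ge> (G\<^sub>\<mu>(t) - \<alpha>)\<^sup>+\<close> for every feasible \<open>\<nu>\<close> and every \<open>t < l\<^sub>m\<^sub>a\<^sub>x\<close>. Removing the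
  mass \<open>\<alpha>\<close> greedily from the letters with the smallest \<open>l\<close> and putting it on a letter of \<open>\<Sigma>\<^sup>0\<close>
  attains all these bounds simultaneously. The payoff is, up to a constant, minus a combination of
  the \<open>G\<^sub>\<nu>(t)\<close> with positive weights (Abel summation), so a feasible \<open>\<nu>\<close> is a maximizer exactly when
  it attains all these bounds, and differences of consecutive values of \<open>G\<^sub>\<nu>\<close> are the masses of the
  \<open>\<Sigma>\<^sub>k\<close>.\<close>

section \<open>Stochastic dominance on a finite set\<close>

text \<open>The bound \<open>M\<close> is kept general so that the induction can pass to \<open>M = l x\<close>, where \<open>x\<close> is a
  letter of maximal \<open>l\<close>. Only thresholds \<open>t < M\<close> are constrained, because under ties removing \<open>x\<close>
  may destroy the sign condition at \<open>t = l x\<close>.\<close>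

lemma dominance:
  fixes l d :: "'a \<Rightarrow> real"
  assumes "finite T" and "\<forall>i\<in>T. l i \<le> M"
    and "\<forall>t<M. sum d {i\<in>T. l i \<le> t} \<le> 0"
  shows "(\<Sum>i\<in>T. (M - l i) * d i) \<le> 0 \<and>
    ((\<Sum>i\<in>T. (M - l i) * d i) = 0 \<longrightarrow> (\<forall>t<M. sum d {i\<in>T. l i \<le> t} = 0))"
  using assms
proof (induction T arbitrary: M rule: finite_ranking_induct[where f = l])
  case empty
  then show ?case by simp
next
  case (insert x T)
  show ?case
  proof (cases "x \<in> T")
    case True
    then show ?thesis
      using insert.IH[OF insert.prems(1,2)[unfolded insert_absorb[OF True]]]
      by (simp add: insert_absorb)
  next
    case False
    have below: "{i \<in> insert x T. l i \<le> t} = {i\<in>T. l i \<le> t}" if "t < l x" for t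
      using that by auto
    have above: "{i \<in> insert x T. l i \<le> t} = insert x T" if "l x \<le> t" for t
      using that insert.hyps(2) by force
    have xM: "l x \<le> M"
      using insert.prems by simp
    let ?A = "\<Sum>i\<in>T. (l x - l i) * d i"
    let ?B = "(M - l x) * sum d (insert x T)"
    \<comment> \<open>Below \<open>l x\<close> the sets with and without \<open>x\<close> agree, so
      the sign condition survives for the smaller bound \<open>l x\<close>.\<close>
    have "\<forall>t<l x. sum d {i\<in>T. l i \<le> t} \<le> 0"
      using insert.prems(2) xM below by (metis less_le_trans)
    then have IH: "?A \<le> 0" "?A = 0 \<Longrightarrow> \<forall>t<l x. sum d {i\<in>T. l i \<le> t} = 0"
      using insert.IH[of "l x"] insert.hyps(2) by auto
    \<comment> \<open>One Abel summation step: \<open>M - l i = (l x - l i) + (M - l x)\<close>, and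
      the term of \<open>x\<close> in the first part vanishes.\<close>
    have split: "(\<Sum>i\<in>insert x T. (M - l i) * d i) = ?A + ?B"
      using insert.hyps(1) False
      by (simp add: algebra_simps sum.distrib sum_subtractf sum_distrib_left)
    have tot: "sum d (insert x T) \<le> 0" if "l x < M"
      using insert.prems(2) above[of "l x"] that by fastforce
    \<comment> \<open>If \<open>l x = M\<close>, nothing is known about the total of
      \<open>d\<close>, but the factor \<open>M - l x\<close> is zero.\<close>
    have B: "?B \<le> 0"
      using tot xM by (cases "l x = M") (auto intro!: mult_nonneg_nonpos)
    have eq: "sum d {i \<in> insert x T. l i \<le> t} = 0"
      if "(\<Sum>i\<in>insert x T. (M - l i) * d i) = 0" "t < M" for t
    proof (cases "t < l x")
      case True
      have "?A = 0" using that split B IH(1) by linarith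
      then show ?thesis using IH(2) True below by simp
    next
      \<comment> \<open>Here \<open>l x \<le> t < M\<close>, so \<open>M - l x\<close> is positive
        and can be cancelled from \<open>?B = 0\<close>.\<close>
      case False
      have "?B = 0" using that split B IH(1) by linarith
      then show ?thesis using False that(2) above by simp
    qed
    show ?thesis
      using split IH(1) B eq by auto
  qed
qed

section \<open>The greedy vector\<close>

text \<open>The amount \<open>a\<close> is taken from the letters in increasing order of
  \<open>l\<close>. In the induction \<open>x\<close> is a letter with largest \<open>l\<close>, so
  it loses mass only after all of \<open>T\<close> has been emptied.\<close>

lemma greedy_removal:
  fixes l \<mu> :: "'a \<Rightarrow> real"
  assumes "finite T" and "\<forall>i\<in>T. 0 \<le> \<mu> i" and "0 \<le> a" and "a \<le> sum \<mu> T"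
  shows "\<exists>\<nu>. (\<forall>i\<in>T. 0 \<le> \<nu> i \<and> \<nu> i \<le> \<mu> i) \<and> sum \<nu> T = sum \<mu> T - a \<and>
    (\<forall>t. sum \<nu> {i\<in>T. l i \<le> t} = pos_part (sum \<mu> {i\<in>T. l i \<le> t} - a))"
  using assms
proof (induction T rule: finite_ranking_induct[where f = l])
  case empty
  then show ?case by (auto simp: pos_part_def)
next
  case (insert x T)
  have below: "{i \<in> insert x T. l i \<le> t} = {i\<in>T. l i \<le> t}" if "t < l x" for t
    using that by auto
  have above: "{i \<in> insert x T. l i \<le> t} = insert x T" if "l x \<le> t" for t
    using that insert.hyps(2) by force
  consider (dup) "x \<in> T" | (le) "x \<notin> T" "a \<le> sum \<mu> T" | (gt) "x \<notin> T" "sum \<mu> T < a"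
    by linarith
  then show ?case
  proof cases
    case dup
    then show ?thesis
      using insert by (simp add: insert_absorb)
  next
    case le
    then obtain \<nu> where \<nu>: "\<forall>i\<in>T. 0 \<le> \<nu> i \<and> \<nu> i \<le> \<mu> i" "sum \<nu> T = sum \<mu> T - a"
      "\<And>t. sum \<nu> {i\<in>T. l i \<le> t} = pos_part (sum \<mu> {i\<in>T. l i \<le> t} - a)"
      using insert by auto
    \<comment> \<open>All of \<open>a\<close> is removed inside \<open>T\<close>, so
      \<open>x\<close> keeps its mass.\<close>
    let ?n = "\<nu>(x := \<mu> x)"
    have same: "sum ?n A = sum \<nu> A" if "A \<subseteq> T" for A
      using that le(1) by (intro sum.cong) auto
    have tot: "sum ?n (insert x T) = sum \<mu> (insert x T) - a"
      using insert.hyps(1) le(1) same[of T] \<nu>(2) by simp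
    have "sum ?n {i\<in>insert x T. l i \<le> t} = pos_part (sum \<mu> {i\<in>insert x T. l i \<le> t} - a)" for t
      using below[of t] above[of t] same[of "{i\<in>T. l i \<le> t}"] \<nu>(3) tot insert.prems
      by (cases "t < l x") (auto simp: pos_part_def)
    then show ?thesis
      using tot \<nu>(1) insert.prems insert.hyps le by (intro exI[of _ ?n]) auto
  next
    case gt
    \<comment> \<open>\<open>T\<close> is emptied and \<open>x\<close> gives up the rest,
      \<open>a - sum \<mu> T\<close>.\<close>
    let ?n = "\<lambda>i. if i = x then sum \<mu> (insert x T) - a else 0"
    have zero: "sum ?n A = 0" if "A \<subseteq> T" for A
      using that gt(1) by (intro sum.neutral) auto
    have tot: "sum ?n (insert x T) = sum \<mu> (insert x T) - a"
      using insert.hyps(1) gt(1) zero[of T] by simp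
    have "sum \<mu> {i\<in>T. l i \<le> t} \<le> sum \<mu> T" for t
      using insert by (intro sum_mono2) auto
    then have "sum \<mu> {i\<in>T. l i \<le> t} \<le> a" for t
      using gt(2) by (meson less_imp_le order_trans)
    then have "sum ?n {i\<in>insert x T. l i \<le> t} = pos_part (sum \<mu> {i\<in>insert x T. l i \<le> t} - a)" for t
      using below[of t] above[of t] zero[of "{i\<in>T. l i \<le> t}"] tot insert.prems gt
      by (cases "t < l x") (auto simp: pos_part_def max_def)
    then show ?thesis
      using tot insert.prems insert.hyps gt by (intro exI[of _ ?n]) auto
  qed
qed

section \<open>Cumulative masses of feasible vectors\<close>

lemma half_L1_bound:
  fixes d :: "'a \<Rightarrow> real"
  assumes "finite S" and "sum d S = 0" and "A \<subseteq> S"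
  shows "2 * sum d A \<le> (\<Sum>i\<in>S. \<bar>d i\<bar>)"
proof -
  \<comment> \<open>The sums of \<open>d\<close> over \<open>A\<close> and over its complement are
    opposite, so each accounts for at most half of the total variation.\<close>
  have "sum d S = sum d (S - A) + sum d A"
    "(\<Sum>i\<in>S. \<bar>d i\<bar>) = (\<Sum>i\<in>S - A. \<bar>d i\<bar>) + (\<Sum>i\<in>A. \<bar>d i\<bar>)"
    using assms by (simp_all add: sum.subset_diff)
  moreover have "\<bar>sum d A\<bar> \<le> (\<Sum>i\<in>A. \<bar>d i\<bar>)" "\<bar>sum d (S - A)\<bar> \<le> (\<Sum>i\<in>S - A. \<bar>d i\<bar>)"
    by (rule sum_abs)+
  ultimately show ?thesis using assms(2) by linarith
qed

lemma sum_Sigma_top_eq: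
  assumes "finite S"
  shows "sum f S = sum f (S - Sigma_top S l) + sum f (Sigma_top S l)"
  using assms by (intro sum.subset_diff) (auto simp: Sigma_top_def)

lemma below_l_max_subset:
  assumes "t < l_max S l"
  shows "{i\<in>S. l i \<le> t} \<subseteq> S - Sigma_top S l"
  using assms by (auto simp: Sigma_top_def)

lemma Sigma_top_nonempty:
  assumes "finite S" and "S \<noteq> {}"
  shows "Sigma_top S l \<noteq> {}"
proof -
  have "l_max S l \<in> l ` S"
    using assms by (simp add: l_max_def)
  then show ?thesis by (auto simp: Sigma_top_def)
qed

text \<open>These are the conditions under which \<open>greedy_removal\<close> can take \<alpha>
  from the letters outside \<open>Sigma_top\<close>.\<close>

lemma alpha_bounds:
  assumes "finite S" and "\<mu> \<in> prob_vectors S" and "0 \<le> R"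
  shows "0 \<le> alpha S \<mu> l R" and "alpha S \<mu> l R \<le> sum \<mu> (S - Sigma_top S l)"
proof -
  have "0 \<le> sum \<mu> (S - Sigma_top S l)"
    using assms by (intro sum_nonneg) (auto simp: prob_vectors_def)
  then show "0 \<le> alpha S \<mu> l R" "alpha S \<mu> l R \<le> sum \<mu> (S - Sigma_top S l)"
    using assms sum_Sigma_top_eq[of S \<mu> l] by (auto simp: alpha_def prob_vectors_def)
qed

text \<open>The two terms of the minimum in \<open>alpha\<close> are treated separately:
  \<open>half_L1_bound\<close> for \<open>\<mu> - \<nu>\<close> limits the loss to
  \<open>R / 2\<close>; and the sublevel set misses \<open>Sigma_top\<close>, so subtracting the
  other term leaves nothing positive.\<close>

lemma feasible_lower_bound:
  assumes "finite S" and "\<mu> \<in> prob_vectors S" and "\<nu> \<in> feasible S \<mu> R" and "t < l_max S l"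
  shows "pos_part (sum \<mu> {i\<in>S. l i \<le> t} - alpha S \<mu> l R) \<le> sum \<nu> {i\<in>S. l i \<le> t}"
proof -
  let ?A = "{i\<in>S. l i \<le> t}"
  have nn: "0 \<le> sum \<nu> ?A"
    using assms by (intro sum_nonneg) (auto simp: feasible_def prob_vectors_def)
  have "2 * (\<Sum>i\<in>?A. \<mu> i - \<nu> i) \<le> (\<Sum>i\<in>S. \<bar>\<mu> i - \<nu> i\<bar>)"
    using assms
    by (intro half_L1_bound) (auto simp: feasible_def prob_vectors_def sum_subtractf)
  also have "\<dots> \<le> R"
    using assms by (simp add: feasible_def abs_minus_commute)
  finally have "sum \<mu> ?A - R / 2 \<le> sum \<nu> ?A"
    by (simp add: sum_subtractf)
  moreover have "sum \<mu> ?A \<le> sum \<mu> (S - Sigma_top S l)"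
    using assms below_l_max_subset[of t S l]
    by (intro sum_mono2) (auto simp: prob_vectors_def)
  then have "sum \<mu> ?A \<le> 1 - sum \<mu> (Sigma_top S l)"
    using assms sum_Sigma_top_eq[of S \<mu> l] by (simp add: prob_vectors_def)
  ultimately show ?thesis
    using nn by (auto simp: pos_part_def alpha_def min_def)
qed

text \<open>The mass \<alpha> removed below the top is placed on a single letter \<open>u\<close> of
  \<open>Sigma_top\<close>. Removal and addition each cost \<alpha> in total variation, and
  \<open>2 * \<alpha> \<le> R\<close>.\<close>

lemma greedy_feasible:
  assumes "finite S" and "S \<noteq> {}" and "\<mu> \<in> prob_vectors S" and "0 \<le> R"
  shows "\<exists>\<nu>\<in>feasible S \<mu> R. \<forall>t<l_max S l.
    sum \<nu> {i\<in>S. l i \<le> t} = pos_part (sum \<mu> {i\<in>S. l i \<le> t} - alpha S \<mu> l R)"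
proof -
  let ?U = "Sigma_top S l" and ?T = "S - Sigma_top S l" and ?a = "alpha S \<mu> l R"
  note a = alpha_bounds[OF assms(1,3,4), of l]
  have \<mu>: "\<And>i. i \<in> S \<Longrightarrow> 0 \<le> \<mu> i" "sum \<mu> S = 1"
    using assms(3) by (auto simp: prob_vectors_def)
  obtain \<nu> where \<nu>: "\<forall>i\<in>?T. 0 \<le> \<nu> i \<and> \<nu> i \<le> \<mu> i" "sum \<nu> ?T = sum \<mu> ?T - ?a"
    "\<And>t. sum \<nu> {i\<in>?T. l i \<le> t} = pos_part (sum \<mu> {i\<in>?T. l i \<le> t} - ?a)"
    using greedy_removal[of ?T \<mu> ?a l] a assms(1) \<mu>(1) by auto
  obtain u where u: "u \<in> ?U"
    using Sigma_top_nonempty[OF assms(1,2)] by blast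
  have US: "?U \<subseteq> S" and fU: "finite ?U"
    using assms(1) by (auto simp: Sigma_top_def)
  define n where "n i = (if i \<in> ?T then \<nu> i else \<mu> i + (if i = u then ?a else 0))" for i
  have nT: "sum n A = sum \<nu> A" if "A \<subseteq> ?T" for A
    using that by (intro sum.cong) (auto simp: n_def)
  have "sum n ?U = (\<Sum>i\<in>?U. \<mu> i + (if i = u then ?a else 0))"
    by (intro sum.cong) (auto simp: n_def)
  also have "\<dots> = sum \<mu> ?U + ?a"
    using u fU by (simp add: sum.distrib)
  finally have tot: "sum n S = 1"
    using sum_Sigma_top_eq[OF assms(1), of n l] sum_Sigma_top_eq[OF assms(1), of \<mu> l]
      nT[of ?T] \<nu>(2) \<mu>(2) by simp
  have "(\<Sum>i\<in>?T. \<bar>n i - \<mu> i\<bar>) = (\<Sum>i\<in>?T. \<mu> i - \<nu> i)"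
    using \<nu>(1) by (intro sum.cong) (auto simp: n_def)
  also have "\<dots> = ?a"
    using \<nu>(2) by (simp add: sum_subtractf)
  finally have dT: "(\<Sum>i\<in>?T. \<bar>n i - \<mu> i\<bar>) = ?a" .
  have "(\<Sum>i\<in>?U. \<bar>n i - \<mu> i\<bar>) = (\<Sum>i\<in>?U. if i = u then ?a else 0)"
    using a(1) by (intro sum.cong) (auto simp: n_def)
  also have "\<dots> = ?a"
    using u fU by simp
  finally have "(\<Sum>i\<in>S. \<bar>n i - \<mu> i\<bar>) = 2 * ?a"
    using dT sum_Sigma_top_eq[OF assms(1), of "\<lambda>i. \<bar>n i - \<mu> i\<bar>" l] by simp
  moreover have "2 * ?a \<le> R"
    by (simp add: alpha_def min_def)
  moreover have "0 \<le> n i" if "i \<in> S" for i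
    using that \<nu>(1) \<mu>(1) a(1) by (auto simp: n_def)
  ultimately have "n \<in> feasible S \<mu> R"
    using tot by (simp add: feasible_def prob_vectors_def)
  moreover have "sum n {i\<in>S. l i \<le> t} = pos_part (sum \<mu> {i\<in>S. l i \<le> t} - ?a)"
    if "t < l_max S l" for t
  proof -
    have "{i\<in>S. l i \<le> t} = {i\<in>?T. l i \<le> t}"
      using that below_l_max_subset[of t S l] by auto
    then show ?thesis
      using \<nu>(3)[of t] nT[of "{i\<in>?T. l i \<le> t}"] by auto
  qed
  ultimately show ?thesis by blast
qed

section \<open>Comparison of payoffs and maximizers\<close>

lemma payoff_dominance:
  assumes "finite S" and "p \<in> feasible S \<mu> R" and "q \<in> feasible S \<mu> R"
    and "\<forall>t<l_max S l. sum p {i\<in>S. l i \<le> t} \<le> sum q {i\<in>S. l i \<le> t}"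
  shows "payoff S l q \<le> payoff S l p"
    and "payoff S l p \<le> payoff S l q \<Longrightarrow>
      \<forall>t<l_max S l. sum q {i\<in>S. l i \<le> t} = sum p {i\<in>S. l i \<le> t}"
proof -
  let ?d = "\<lambda>i. p i - q i"
  have "sum p S = 1" "sum q S = 1"
    using assms by (auto simp: feasible_def prob_vectors_def)
  \<comment> \<open>The total masses cancel, so the sum treated by \<open>dominance\<close> with
    \<open>M = l_max S l\<close> is exactly the difference of the payoffs.\<close>
  moreover have "(\<Sum>i\<in>S. (l_max S l - l i) * ?d i)
      = l_max S l * (sum p S - sum q S) - payoff S l p + payoff S l q"
    by (simp add: payoff_def algebra_simps sum.distrib sum_subtractf sum_distrib_left)
  ultimately have eq: "(\<Sum>i\<in>S. (l_max S l - l i) * ?d i) = payoff S l q - payoff S l p"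
    by simp
  have "(\<Sum>i\<in>S. (l_max S l - l i) * ?d i) \<le> 0 \<and>
    ((\<Sum>i\<in>S. (l_max S l - l i) * ?d i) = 0 \<longrightarrow>
      (\<forall>t<l_max S l. sum ?d {i\<in>S. l i \<le> t} = 0))"
    using assms by (intro dominance) (auto simp: l_max_def sum_subtractf)
  then show "payoff S l q \<le> payoff S l p"
    and "payoff S l p \<le> payoff S l q \<Longrightarrow>
      \<forall>t<l_max S l. sum q {i\<in>S. l i \<le> t} = sum p {i\<in>S. l i \<le> t}"
    unfolding eq by (auto simp: sum_subtractf)
qed

lemma maximizer_exists:
  assumes "finite S" and "S \<noteq> {}" and "\<mu> \<in> prob_vectors S" and "0 \<le> R"
  shows "\<exists>\<nu>. maximizer S \<mu> l R \<nu>"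
proof -
  obtain p where p: "p \<in> feasible S \<mu> R"
    "\<forall>t<l_max S l. sum p {i\<in>S. l i \<le> t} = pos_part (sum \<mu> {i\<in>S. l i \<le> t} - alpha S \<mu> l R)"
    using greedy_feasible[OF assms] by blast
  have "payoff S l q \<le> payoff S l p" if "q \<in> feasible S \<mu> R" for q
    using payoff_dominance(1)[OF assms(1) p(1) that]
      feasible_lower_bound[OF assms(1,3) that] p(2) by simp
  then show ?thesis
    using p(1) by (auto simp: maximizer_def is_arg_max_def not_less)
qed

text \<open>A maximizer does at least as well as the greedy vector, which forces the equality case
  of \<open>payoff_dominance\<close>.\<close>

lemma maximizer_cumulative:
  assumes "finite S" and "S \<noteq> {}" and "\<mu> \<in> prob_vectors S" and "0 \<le> R"
    and "maximizer S \<mu> l R \<nu>" and "t < l_max S l"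
  shows "sum \<nu> {i\<in>S. l i \<le> t} = pos_part (sum \<mu> {i\<in>S. l i \<le> t} - alpha S \<mu> l R)"
proof -
  obtain p where p: "p \<in> feasible S \<mu> R"
    "\<forall>t<l_max S l. sum p {i\<in>S. l i \<le> t} = pos_part (sum \<mu> {i\<in>S. l i \<le> t} - alpha S \<mu> l R)"
    using greedy_feasible[OF assms(1-4)] by blast
  have \<nu>: "\<nu> \<in> feasible S \<mu> R" "payoff S l p \<le> payoff S l \<nu>"
    using assms(5) p(1) by (auto simp: maximizer_def is_arg_max_def not_less)
  have "\<forall>t<l_max S l. sum \<nu> {i\<in>S. l i \<le> t} = sum p {i\<in>S. l i \<le> t}"
    using feasible_lower_bound[OF assms(1,3) \<nu>(1)] p(2) \<nu>(2)
    by (intro payoff_dominance(2)[OF assms(1) p(1) \<nu>(1)]) auto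
  then show ?thesis
    using p(2) assms(6) by simp
qed

lemma D_plus_eq_payoff:
  assumes "maximizer S \<mu> l R \<nu>"
  shows "D_plus S \<mu> l R = payoff S l \<nu>"
  unfolding D_plus_def
  using assms by (intro cSup_eq_maximum) (auto simp: maximizer_def is_arg_max_def not_less)

section \<open>The level sets\<close>

lemma remaining_Suc: "remaining S l (Suc k) = remaining S l k - Sigma_low S l k"
  by (auto simp: remaining_def lessThan_Suc)

lemma remaining_antimono: "j \<le> k \<Longrightarrow> remaining S l k \<subseteq> remaining S l j"
  by (fastforce simp: remaining_def)

lemma remaining_0_nonempty:
  assumes "finite S" and "S \<noteq> {}" and "l_min S l < l_max S l"
  shows "remaining S l 0 \<noteq> {}"
proof -
  have "l_min S l \<in> l ` S"
    using assms by (simp add: l_min_def)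
  then show ?thesis
    using assms by (auto simp: remaining_def Sigma_top_def)
qed

text \<open>Allows the separately defined set with index 0 to be treated like the later
  levels.\<close>

lemma level_0:
  assumes "finite S" and "S \<noteq> {}" and "l_min S l < l_max S l"
  shows "level S l 0 = l_min S l"
  unfolding level_def
proof (rule Min_eqI)
  show "finite (l ` remaining S l 0)"
    using assms by (simp add: remaining_def)
  show "l_min S l \<le> y" if "y \<in> l ` remaining S l 0" for y
    using that assms by (auto simp: remaining_def l_min_def)
  have "l_min S l \<in> l ` S"
    using assms by (simp add: l_min_def)
  then show "l_min S l \<in> l ` remaining S l 0"
    using assms by (auto simp: remaining_def Sigma_top_def)
qed

lemma Sigma_low_saturated:
  assumes "i \<in> Sigma_low S l k" and "i' \<in> S" and "l i' = l i"
  shows "i' \<in> Sigma_low S l k"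
  using assms by (subst (asm) Sigma_low.simps, subst Sigma_low.simps)
    (auto simp: Let_def split: if_splits)

lemma Sigma_low_empty:
  assumes "remaining S l k = {}" and "k \<noteq> 0"
  shows "Sigma_low S l k = {}"
  using assms by (subst Sigma_low.simps) (simp add: remaining_def Let_def)

lemma Sigma_low_eq:
  assumes "finite S" and "S \<noteq> {}" and "l_min S l < l_max S l" and "remaining S l k \<noteq> {}"
  shows "Sigma_low S l k = {i\<in>S. l i = level S l k}"
  using assms Sigma_low_level[of k S l] level_0[of S l] Sigma_low_0[of S l]
  by (cases "k = 0") auto

lemma level_attained:
  assumes "finite S" and "remaining S l k \<noteq> {}"
  obtains x where "x \<in> remaining S l k" and "l x = level S l k"
proof -
  have "level S l k \<in> l ` remaining S l k"
    unfolding level_def using assms by (intro Min_in) (auto simp: remaining_def)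
  then show ?thesis using that by force
qed

lemma level_less_l_max:
  assumes "finite S" and "remaining S l k \<noteq> {}"
  shows "level S l k < l_max S l"
proof -
  obtain x where x: "x \<in> remaining S l k" "l x = level S l k"
    using level_attained[OF assms] .
  then have "x \<in> S" "l x \<noteq> l_max S l"
    by (auto simp: remaining_def Sigma_top_def)
  moreover have "l x \<le> l_max S l"
    using \<open>x \<in> S\<close> assms(1) by (simp add: l_max_def)
  ultimately show ?thesis using x(2) by simp
qed

text \<open>Some remaining \<open>x\<close> attains the level. A letter with the same value of
  \<open>l\<close> that was already removed would, by saturation, have taken \<open>x\<close> with
  it.\<close>

lemma Sigma_low_subset_remaining:
  assumes "finite S" and "S \<noteq> {}" and "l_min S l < l_max S l"
  shows "Sigma_low S l k \<subseteq> remaining S l k"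
proof (cases "remaining S l k = {}")
  case True
  then show ?thesis
    using Sigma_low_empty[of S l k] remaining_0_nonempty[OF assms] by (cases "k = 0") auto
next
  case False
  obtain x where x: "x \<in> remaining S l k" "l x = level S l k"
    using level_attained[OF assms(1) False] .
  show ?thesis
  proof
    fix i assume "i \<in> Sigma_low S l k"
    then have i: "i \<in> S" "l x = l i"
      using Sigma_low_eq[OF assms False] x by auto
    then show "i \<in> remaining S l k"
      using x(1) Sigma_low_saturated[of i S l _ x]
      by (auto simp: remaining_def Sigma_top_def)
  qed
qed

text \<open>Levels increase strictly: minima over shrinking sets do not decrease, and a repeated
  value would have been removed earlier. Conversely, a letter below the current minimum is neither
  remaining nor in \<open>Sigma_top\<close>.\<close>

lemma Union_Sigma_low_eq:
  assumes "finite S" and "S \<noteq> {}" and "l_min S l < l_max S l" and "remaining S l k \<noteq> {}"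
  shows "(\<Union>j<k. Sigma_low S l j) = {i\<in>S. l i < level S l k}"
proof (intro equalityI subsetI)
  fix i assume "i \<in> (\<Union>j<k. Sigma_low S l j)"
  then obtain j where j: "j < k" "i \<in> Sigma_low S l j" by blast
  obtain x where x: "x \<in> remaining S l k" "l x = level S l k"
    using level_attained[OF assms(1,4)] .
  have xj: "x \<in> remaining S l j"
    using x(1) j(1) remaining_antimono[of j k S l] by auto
  have i: "i \<in> S" "l i = level S l j"
    using j(2) Sigma_low_eq[OF assms(1-3), of j] xj by auto
  have "level S l j \<le> l x"
    unfolding level_def using xj assms(1) by (intro Min_le) (auto simp: remaining_def)
  moreover have "l x \<noteq> l i"
    using Sigma_low_saturated[OF j(2), of x] x(1) j(1) by (auto simp: remaining_def)
  ultimately show "i \<in> {i\<in>S. l i < level S l k}"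
    using i x(2) by auto
next
  fix i assume i: "i \<in> {i\<in>S. l i < level S l k}"
  then have "i \<notin> Sigma_top S l"
    using level_less_l_max[OF assms(1,4)] by (auto simp: Sigma_top_def)
  moreover have "i \<notin> remaining S l k"
  proof
    assume "i \<in> remaining S l k"
    then have "level S l k \<le> l i"
      unfolding level_def using assms(1) by (intro Min_le) (auto simp: remaining_def)
    with i show False by simp
  qed
  ultimately show "i \<in> (\<Union>j<k. Sigma_low S l j)"
    using i by (auto simp: remaining_def)
qed

lemma sum_Union_Sigma_low:
  assumes "finite S" and "S \<noteq> {}" and "l_min S l < l_max S l"
  shows "sum f (\<Union>j<k. Sigma_low S l j) = (\<Sum>j<k. sum f (Sigma_low S l j))"
proof (induction k)
  case 0
  then show ?case by simp
next
  case (Suc k)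
  have fin: "finite (Sigma_low S l j)" for j
    using Sigma_low_subset_remaining[OF assms, of j] assms(1)
    by (auto simp: remaining_def intro: finite_subset)
  have "(\<Union>j<k. Sigma_low S l j) \<inter> Sigma_low S l k = {}"
    using Sigma_low_subset_remaining[OF assms, of k] by (auto simp: remaining_def)
  then have "sum f ((\<Union>j<k. Sigma_low S l j) \<union> Sigma_low S l k)
      = sum f (\<Union>j<k. Sigma_low S l j) + sum f (Sigma_low S l k)"
    using fin by (intro sum.union_disjoint) auto
  then show ?case
    using Suc by (simp add: lessThan_Suc Un_commute add.commute)
qed

text \<open>Each stage with letters left removes at least one of them, so the recursion is exhausted
  after at most \<open>card S\<close> stages.\<close>

lemma card_remaining_le:
  assumes "finite S" and "S \<noteq> {}" and "l_min S l < l_max S l"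
  shows "card (remaining S l k) \<le> card S - k"
proof (induction k)
  case 0
  then show ?case
    using assms(1) by (simp add: remaining_def card_mono)
next
  case (Suc k)
  show ?case
  proof (cases "remaining S l k = {}")
    case True
    then show ?thesis by (simp add: remaining_Suc)
  next
    case False
    obtain x where x: "x \<in> remaining S l k" "l x = level S l k"
      using level_attained[OF assms(1) False] .
    then have "x \<in> Sigma_low S l k"
      using Sigma_low_eq[OF assms False] by (auto simp: remaining_def)
    then have "remaining S l (Suc k) \<subset> remaining S l k"
      using x by (auto simp: remaining_Suc)
    then have "card (remaining S l (Suc k)) < card (remaining S l k)"
      using assms(1) by (intro psubset_card_mono) (auto simp: remaining_def)
    then show ?thesis using Suc by linarith
  qed
qed

text \<open>The nonempty stages form an initial segment, because the remaining sets decrease; so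
  their number determines which ones they are.\<close>

lemma remaining_nonempty_iff:
  assumes "finite S" and "S \<noteq> {}" and "l_min S l < l_max S l"
  shows "remaining S l k \<noteq> {} \<longleftrightarrow> k \<le> num_levels S l"
proof -
  define N where "N = (LEAST k. remaining S l k = {})"
  have "finite (remaining S l (card S))"
    using assms(1) by (simp add: remaining_def)
  then have "remaining S l (card S) = {}"
    using card_remaining_le[OF assms, of "card S"] by simp
  then have N: "remaining S l N = {}"
    unfolding N_def by (rule LeastI)
  have iff: "remaining S l j \<noteq> {} \<longleftrightarrow> j < N" for j
    using N remaining_antimono[of N j S l] not_less_Least[of j "\<lambda>k. remaining S l k = {}"]
    by (auto simp: N_def[symmetric] not_less)
  have "N \<noteq> 0"
    using N remaining_0_nonempty[OF assms] by metis
  \<comment> \<open>Stage 0 is nonempty but not counted, so the count is \<open>N - 1\<close> and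
    \<open>k < N\<close> turns into \<open>k \<le> num_levels S l\<close>.\<close>
  moreover have "{k. 1 \<le> k \<and> remaining S l k \<noteq> {}} = {1..<N}"
    using iff by auto
  ultimately show ?thesis
    using iff[of k] by (auto simp: num_levels_def)
qed

lemma Union_all_Sigma_low:
  assumes "finite S" and "S \<noteq> {}" and "l_min S l < l_max S l"
  shows "(\<Union>j<Suc (num_levels S l). Sigma_low S l j) = S - Sigma_top S l"
proof
  show "S - Sigma_top S l \<subseteq> (\<Union>j<Suc (num_levels S l). Sigma_low S l j)"
    using remaining_nonempty_iff[OF assms, of "Suc (num_levels S l)"]
    by (auto simp: remaining_def)
  show "(\<Union>j<Suc (num_levels S l). Sigma_low S l j) \<subseteq> S - Sigma_top S l"
    using Sigma_low_subset_remaining[OF assms] by (fastforce simp: remaining_def)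
qed

text \<open>The level sets and \<open>Sigma_top\<close> partition \<open>S\<close>, and
  \<open>l\<close> is constant on each of them.\<close>

lemma payoff_by_levels:
  assumes "finite S" and "S \<noteq> {}" and "l_min S l < l_max S l"
  shows "payoff S l \<nu> = l_max S l * sum \<nu> (Sigma_top S l) + l_min S l * sum \<nu> (Sigma_low S l 0)
    + (\<Sum>k = 1..num_levels S l. level S l k * sum \<nu> (Sigma_low S l k))"
proof -
  let ?f = "\<lambda>i. l i * \<nu> i" and ?r = "num_levels S l"
  have top: "sum ?f (Sigma_top S l) = l_max S l * sum \<nu> (Sigma_top S l)"
    by (simp add: sum_distrib_left Sigma_top_def)
  have low: "sum ?f (Sigma_low S l k) = level S l k * sum \<nu> (Sigma_low S l k)" if "k \<le> ?r" for k
    using Sigma_low_eq[OF assms, of k] remaining_nonempty_iff[OF assms, of k] that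
    by (simp add: sum_distrib_left)
  have "sum ?f (S - Sigma_top S l) = (\<Sum>k<Suc ?r. sum ?f (Sigma_low S l k))"
    using sum_Union_Sigma_low[OF assms, of ?f "Suc ?r"] Union_all_Sigma_low[OF assms] by simp
  also have "\<dots> = (\<Sum>k<Suc ?r. level S l k * sum \<nu> (Sigma_low S l k))"
    using low by (intro sum.cong) auto
  also have "\<dots> = l_min S l * sum \<nu> (Sigma_low S l 0)
      + (\<Sum>k = 1..?r. level S l k * sum \<nu> (Sigma_low S l k))"
    unfolding lessThan_Suc_atMost atMost_atLeast0
    by (simp add: sum.atLeast_Suc_atMost level_0[OF assms])
  finally show ?thesis
    using sum_Sigma_top_eq[OF assms(1), of ?f l] top by (simp add: payoff_def)
qed

section \<open>Masses of a maximizer\<close>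

text \<open>Translates bounds at the threshold \<open>level S l k\<close> into statements about the
  first \<open>k + 1\<close> level sets.\<close>

lemma cumulative_eq_sum:
  assumes "finite S" and "S \<noteq> {}" and "l_min S l < l_max S l" and "k \<le> num_levels S l"
  shows "sum f {i\<in>S. l i \<le> level S l k} = (\<Sum>j<Suc k. sum f (Sigma_low S l j))"
proof -
  have ne: "remaining S l k \<noteq> {}"
    using remaining_nonempty_iff[OF assms(1-3)] assms(4) by simp
  have "(\<Union>j<Suc k. Sigma_low S l j) = {i\<in>S. l i \<le> level S l k}"
    using Union_Sigma_low_eq[OF assms(1-3) ne] Sigma_low_eq[OF assms(1-3) ne]
    by (auto simp: lessThan_Suc)
  then show ?thesis
    using sum_Union_Sigma_low[OF assms(1-3), of f "Suc k"] by simp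
qed

lemma maximizer_prefix:
  assumes "finite S" and "S \<noteq> {}" and "\<mu> \<in> prob_vectors S" and "l_min S l < l_max S l"
    and "0 \<le> R" and "maximizer S \<mu> l R \<nu>" and "k \<le> num_levels S l"
  shows "(\<Sum>j<Suc k. sum \<nu> (Sigma_low S l j))
    = pos_part ((\<Sum>j<Suc k. sum \<mu> (Sigma_low S l j)) - alpha S \<mu> l R)"
proof -
  have "level S l k < l_max S l"
    using level_less_l_max[OF assms(1)] remaining_nonempty_iff[OF assms(1,2,4)] assms(7) by simp
  from maximizer_cumulative[OF assms(1,2,3,5,6) this] show ?thesis
    unfolding cumulative_eq_sum[OF assms(1,2,4,7)] .
qed

text \<open>With \<open>P\<close> the mass of the earlier levels and \<open>m\<close> that of the
  next one, \<open>pos_part (a - P)\<close> is what is still to be removed when the next level is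
  reached.\<close>

lemma pos_part_increment:
  assumes "0 \<le> m"
  shows "pos_part (P + m - a) - pos_part (P - a) = pos_part (m - pos_part (a - P))"
  using assms by (auto simp: pos_part_def)

lemma maximizer_top_mass:
  assumes "finite S" and "S \<noteq> {}" and "\<mu> \<in> prob_vectors S" and "l_min S l < l_max S l"
    and "0 \<le> R" and "maximizer S \<mu> l R \<nu>"
  shows "sum \<nu> (Sigma_top S l) = sum \<mu> (Sigma_top S l) + alpha S \<mu> l R"
proof -
  let ?T = "S - Sigma_top S l"
  have "sum f ?T = (\<Sum>j<Suc (num_levels S l). sum f (Sigma_low S l j))" for f :: "'a \<Rightarrow> real"
    using sum_Union_Sigma_low[OF assms(1,2,4), of f "Suc (num_levels S l)"]
      Union_all_Sigma_low[OF assms(1,2,4)] by simp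
  then have "sum \<nu> ?T = pos_part (sum \<mu> ?T - alpha S \<mu> l R)"
    using maximizer_prefix[OF assms, of "num_levels S l"] by simp
  moreover have "sum \<nu> S = 1" "sum \<mu> S = 1"
    using assms(3,6) by (auto simp: maximizer_def is_arg_max_def feasible_def prob_vectors_def)
  \<comment> \<open>By \<open>alpha_bounds\<close> the argument of \<open>pos_part\<close> is
    nonnegative, so exactly \<alpha> leaves the lower letters and must sit on top.\<close>
  ultimately show ?thesis
    using alpha_bounds(2)[OF assms(1,3,5), of l] sum_Sigma_top_eq[OF assms(1), of \<nu> l]
      sum_Sigma_top_eq[OF assms(1), of \<mu> l] by (simp add: pos_part_def)
qed

text \<open>The mass of one level is the difference of two consecutive prefix masses, rewritten by
  \<open>pos_part_increment\<close>.\<close>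

lemma maximizer_low_mass:
  assumes "finite S" and "S \<noteq> {}" and "\<mu> \<in> prob_vectors S" and "l_min S l < l_max S l"
    and "0 \<le> R" and "maximizer S \<mu> l R \<nu>" and "k \<in> {1..num_levels S l}"
  shows "sum \<nu> (Sigma_low S l k) = pos_part (sum \<mu> (Sigma_low S l k)
    - pos_part (alpha S \<mu> l R - (\<Sum>j = 1..k. sum \<mu> (Sigma_low S l (j - 1)))))"
proof -
  let ?P = "\<lambda>f. \<Sum>j<k. sum f (Sigma_low S l j)"
  obtain k' where k': "k = Suc k'" "k' \<le> num_levels S l"
    using assms(7) by (cases k) auto
  have shift: "(\<Sum>j = 1..k. sum \<mu> (Sigma_low S l (j - 1))) = ?P \<mu>"
    by (rule sum.reindex_bij_witness[of _ Suc "\<lambda>j. j - 1"]) auto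
  have "0 \<le> sum \<mu> (Sigma_low S l k)"
    using assms(3) Sigma_low_subset_remaining[OF assms(1,2,4), of k]
    by (intro sum_nonneg) (auto simp: prob_vectors_def remaining_def)
  then have "pos_part (?P \<mu> + sum \<mu> (Sigma_low S l k) - alpha S \<mu> l R)
      - pos_part (?P \<mu> - alpha S \<mu> l R)
      = pos_part (sum \<mu> (Sigma_low S l k) - pos_part (alpha S \<mu> l R - ?P \<mu>))"
    by (rule pos_part_increment)
  moreover have "?P \<nu> + sum \<nu> (Sigma_low S l k)
      = pos_part (?P \<mu> + sum \<mu> (Sigma_low S l k) - alpha S \<mu> l R)"
    using maximizer_prefix[OF assms(1-6), of k] assms(7) by simp
  moreover have "?P \<nu> = pos_part (?P \<mu> - alpha S \<mu> l R)"
    using maximizer_prefix[OF assms(1-6) k'(2)] unfolding k'(1) .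
  ultimately show ?thesis
    unfolding shift by linarith
qed

theorem mainTheorem1:
  fixes S :: "'a set" and \<mu> l :: "'a \<Rightarrow> real" and R :: real
  assumes "finite S" and "S \<noteq> {}"
    and "\<mu> \<in> prob_vectors S"
    and "\<forall>i\<in>S. 0 \<le> l i"
    and "l_min S l < l_max S l"
    and "0 \<le> R" and "R \<le> 2"
  shows "(\<exists>\<nu>. maximizer S \<mu> l R \<nu>) \<and>
    (\<forall>\<nu>. maximizer S \<mu> l R \<nu> \<longrightarrow>
       D_plus S \<mu> l R = payoff S l \<nu> \<and>
       D_plus S \<mu> l R =
         l_max S l * sum \<nu> (Sigma_top S l) + l_min S l * sum \<nu> (Sigma_low S l 0)
         + (\<Sum>k = 1..num_levels S l. level S l k * sum \<nu> (Sigma_low S l k)) \<and>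
       sum \<nu> (Sigma_top S l) = sum \<mu> (Sigma_top S l) + alpha S \<mu> l R \<and>
       sum \<nu> (Sigma_low S l 0) = pos_part (sum \<mu> (Sigma_low S l 0) - alpha S \<mu> l R) \<and>
       (\<forall>k\<in>{1..num_levels S l}.
          sum \<nu> (Sigma_low S l k) =
            pos_part (sum \<mu> (Sigma_low S l k)
              - pos_part (alpha S \<mu> l R - (\<Sum>j = 1..k. sum \<mu> (Sigma_low S l (j - 1)))))))"
  \<comment> \<open>The mass of the lowest level is \<open>maximizer_prefix\<close> at
    \<open>k = 0\<close>, where the prefix is a single set.\<close>
  using maximizer_exists[OF assms(1-3,6)] D_plus_eq_payoff[of S \<mu> l R]
    payoff_by_levels[OF assms(1,2,5)] maximizer_top_mass[OF assms(1-3,5,6)]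
    maximizer_prefix[OF assms(1-3,5,6), of _ 0] maximizer_low_mass[OF assms(1-3,5,6)]
  by simp

end
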